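(* Let $w=(w(k))_{k=1}^\infty$ be a decreasing weight sequence such that $W(\infty)=\infty$, and let $\varphi$ be an Orlicz $N$-function. Then the diameter of every nonempty relatively weakly open subset of the unit ball of the Orlicz-Lorentz sequence space $\lambda_{\varphi,w}$ equipped with the Luxemburg norm is equal to two if and only if $\varphi$ does not satisfy the $\Delta_2^0$ condition.
   Context: Decreasing means non-increasing. A weight sequence is a decreasing sequence $w=(w(k))_{k=1}^\infty$ of positive reals; $W(\infty)=\sum_{k=1}^\infty w(k)$. For a real sequence $x=(x(k))_{k=1}^\infty$, let $d_x(\lambda)$ be the number of $k$ with $|x(k)|>\lambda$, and let $x^*(k)=\inf\{\lambda>0:d_x(\lambda)<k\}$, $k\in\mathbb{N}$, be its decreasing rearrangement (values in $[0,\infty]$, $\inf\emptyset=\infty$). An Orlicz function is a convex $\varphi:[0,\infty)\to[0,\infty)$ with $\varphi(0)=0$ and $\varphi(u)>0$ for $u>0$ (and $\varphi(\infty)=\infty$). It is an Orlicz $N$-function if moreover $\lim_{u\to 0^+}\varphi(u)/u=0$ and $\lim_{u\to\infty}\varphi(u)/u=\infty$. $\varphi$ satisfies $\Delta_2^0$ if there are $K>0$, $u_0>0$ with $\varphi(2u)\le K\varphi(u)$ for all $0\le u\le u_0$. Let $\alpha(x)=\sum_{k=1}^\infty\varphi(x^*(k))w(k)$. The Orlicz-Lorentz sequence space is $\lambda_{\varphi,w}=\{x:\alpha(\lambda x)<\infty\text{ for some }\lambda>0\}$, a real Banach space with the Luxemburg norm $\|x\|=\inf\{\epsilon>0:\alpha(x/\epsilon)\le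 1\}$. The unit ball is the closed unit ball; a relatively weakly open subset of it is its intersection with a weakly open subset of the space; diameter is taken in the Luxemburg norm. *)

theory Defs
  imports "HOL-Analysis.Analysis"
begin

text \<open>Real sequences are functions on \<^typ>\<open>nat\<close> and are indexed from 0, so the entry
  with index \<open>k\<close> stands for the \<open>(k+1)\<close>-st entry in the usual notation.\<close>

definition weight_sequence :: "(nat \<Rightarrow> real) \<Rightarrow> bool" where
  "weight_sequence w \<longleftrightarrow> decseq w \<and> (\<forall>k. 0 < w k)"

definition distr_fun :: "(nat \<Rightarrow> real) \<Rightarrow> real \<Rightarrow> enat" where
  "distr_fun x l =
     (if finite {k. \<bar>x k\<bar> > l} then enat (card {k. \<bar>x k\<bar> > l}) else \<infinity>)"

text \<open>The bound is \<open>Suc k\<close> because of the indexing from 0. In \<^typ>\<open>ennreal\<close> the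
  infimum of the empty set is \<open>\<infinity>\<close>.\<close>

definition decr_rearr :: "(nat \<Rightarrow> real) \<Rightarrow> nat \<Rightarrow> ennreal" where
  "decr_rearr x k = Inf (ennreal ` {l. 0 < l \<and> distr_fun x l < enat (Suc k)})"

text \<open>An Orlicz function is a function on \<open>[0,\<infinity>)\<close>; the values of \<open>\<phi>\<close> at negative
  arguments are irrelevant and never used.\<close>

definition orlicz_function :: "(real \<Rightarrow> real) \<Rightarrow> bool" where
  "orlicz_function \<phi> \<longleftrightarrow> convex_on {0..} \<phi> \<and> \<phi> 0 = 0 \<and> (\<forall>u>0. 0 < \<phi> u)"

definition orlicz_N_function :: "(real \<Rightarrow> real) \<Rightarrow> bool" where
  "orlicz_N_function \<phi> \<longleftrightarrow> orlicz_function \<phi> \<and>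
     ((\<lambda>u. \<phi> u / u) \<longlongrightarrow> 0) (at_right 0) \<and>
     filterlim (\<lambda>u. \<phi> u / u) at_top at_top"

definition delta2_zero :: "(real \<Rightarrow> real) \<Rightarrow> bool" where
  "delta2_zero \<phi> \<longleftrightarrow>
     (\<exists>K>0. \<exists>u0>0. \<forall>u. 0 \<le> u \<and> u \<le> u0 \<longrightarrow> \<phi> (2 * u) \<le> K * \<phi> u)"

text \<open>The extension of \<open>\<phi>\<close> to \<open>[0,\<infinity>]\<close> by \<open>\<phi>(\<infinity>) = \<infinity>\<close>.\<close>

definition orlicz_ext :: "(real \<Rightarrow> real) \<Rightarrow> ennreal \<Rightarrow> ennreal" where
  "orlicz_ext \<phi> t = (if t = \<infinity> then \<infinity> else ennreal (\<phi> (enn2real t)))"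

definition ol_modular :: "(real \<Rightarrow> real) \<Rightarrow> (nat \<Rightarrow> real) \<Rightarrow> (nat \<Rightarrow> real) \<Rightarrow> ennreal" where
  "ol_modular \<phi> w x = (\<Sum>k. orlicz_ext \<phi> (decr_rearr x k) * ennreal (w k))"

definition ol_space :: "(real \<Rightarrow> real) \<Rightarrow> (nat \<Rightarrow> real) \<Rightarrow> (nat \<Rightarrow> real) set" where
  "ol_space \<phi> w = {x. \<exists>l>0. ol_modular \<phi> w (\<lambda>k. l * x k) < \<infinity>}"

definition luxemburg_norm :: "(real \<Rightarrow> real) \<Rightarrow> (nat \<Rightarrow> real) \<Rightarrow> (nat \<Rightarrow> real) \<Rightarrow> real" where
  "luxemburg_norm \<phi> w x = Inf {e. 0 < e \<and> ol_modular \<phi> w (\<lambda>k. x k / e) \<le> 1}"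

definition ol_unit_ball :: "(real \<Rightarrow> real) \<Rightarrow> (nat \<Rightarrow> real) \<Rightarrow> (nat \<Rightarrow> real) set" where
  "ol_unit_ball \<phi> w = {x \<in> ol_space \<phi> w. luxemburg_norm \<phi> w x \<le> 1}"

text \<open>The space depends on \<open>\<phi>\<close> and \<open>w\<close> and hence is a set rather than a type. The
  following notions are for a space \<open>E\<close> of sequences with norm \<open>N\<close>. The values of
  a functional outside \<open>E\<close> are unconstrained and do not matter.\<close>

definition bounded_functionals ::
    "(nat \<Rightarrow> real) set \<Rightarrow> ((nat \<Rightarrow> real) \<Rightarrow> real) \<Rightarrow> ((nat \<Rightarrow> real) \<Rightarrow> real) set" where
  "bounded_functionals E N = {f.
     (\<forall>x\<in>E. \<forall>y\<in>E. f (\<lambda>k. x k + y k) = f x + f y) \<and>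
     (\<forall>c. \<forall>x\<in>E. f (\<lambda>k. c * x k) = c * f x) \<and>
     (\<exists>C. \<forall>x\<in>E. \<bar>f x\<bar> \<le> C * N x)}"

definition weak_topology_on ::
    "(nat \<Rightarrow> real) set \<Rightarrow> ((nat \<Rightarrow> real) \<Rightarrow> real) \<Rightarrow> (nat \<Rightarrow> real) topology" where
  "weak_topology_on E N =
     topology_generated_by {{x \<in> E. f x \<in> U} | f U. f \<in> bounded_functionals E N \<and> open U}"

definition norm_diameter ::
    "((nat \<Rightarrow> real) \<Rightarrow> real) \<Rightarrow> (nat \<Rightarrow> real) set \<Rightarrow> ereal" where
  "norm_diameter N S = (SUP (x, y) \<in> S \<times> S. ereal (N (\<lambda>k. x k - y k)))"

end

theory Submission imports Defs begin

text \<open>If \<open>\<Delta>\<^sub>2\<^sup>0\<close> fails, there are disjointly supported blocks \<open>u\<^sub>i = t\<^sub>i \<chi>(A\<^sub>i)\<close> with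
  \<open>\<alpha>(u\<^sub>i) \<le> 2\<^sup>-\<^sup>i\<close> whose norms tend to 1. Functionals are absolutely summable on disjoint pieces with
  bounded signed sums, so both \<open>u\<^sub>i\<close> and \<open>x \<chi>(A\<^sub>i)\<close> tend weakly to 0. Hence replacing \<open>x\<close> by \<open>\<plusminus>u\<^sub>i\<close> on
  \<open>A\<^sub>i\<close> produces, inside any weak neighbourhood of \<open>x\<close>, two points of the ball at distance \<open>2 \<parallel>u\<^sub>i\<parallel>\<close>,
  once \<open>x\<close> has been shrunk slightly so that \<open>\<alpha>(x) < 1\<close>.

  Under \<open>\<Delta>\<^sub>2\<^sup>0\<close>, let \<open>\<phi>(c) w(0) = 1\<close>. A point of the ball whose entry at 0 is close to \<open>c\<close> has a
  remainder of small modular, which by \<open>\<Delta>\<^sub>2\<^sup>0\<close> has small norm; so these points form a weakly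
  open set of small diameter.\<close>

section \<open>Finite sums against decreasing weights\<close>

text \<open>Summation by parts: \<open>D m\<close> is nonnegative and \<open>w\<close> decreases, so
  the term \<open>D m * w m\<close> carried through the induction survives each change of
  weight.\<close>

lemma sum_mult_decseq_mono:
  fixes a b w :: "nat \<Rightarrow> real"
  assumes "decseq w" "\<And>k. 0 \<le> w k"
    and le: "\<And>m. m \<le> n \<Longrightarrow> (\<Sum>k<m. a k) \<le> (\<Sum>k<m. b k)"
  shows "(\<Sum>k<n. a k * w k) \<le> (\<Sum>k<n. b k * w k)"
proof -
  define D where "D m = (\<Sum>k<m. b k - a k)" for m
  have D: "0 \<le> D m" if "m \<le> n" for m
    using le[OF that] by (simp add: D_def sum_subtractf)
  have "D m * w m \<le> (\<Sum>k<m. (b k - a k) * w k)" if "m \<le> n" for m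
    using that
  proof (induction m)
    case (Suc m)
    have "D (Suc m) * w (Suc m) \<le> D (Suc m) * w m"
      using D[OF Suc.prems] decseqD[OF assms(1), of m "Suc m"] by (simp add: mult_left_mono)
    also have "\<dots> = D m * w m + (b m - a m) * w m" by (simp add: D_def algebra_simps)
    finally show ?case using Suc by simp
  qed (simp add: D_def)
  from this[of n] D[of n] assms(2)[of n] have "0 \<le> (\<Sum>k<n. (b k - a k) * w k)"
    by (meson mult_nonneg_nonneg order.refl order.trans)
  then show ?thesis by (simp add: left_diff_distrib sum_subtractf)
qed

text \<open>The largest of \<open>Suc n\<close> distinct naturals is at least \<open>n\<close>, so
  its weight is at most \<open>w n\<close>; remove it and induct.\<close>

lemma sum_decseq_le_sum_lessThan_card:
  fixes w :: "nat \<Rightarrow> real"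
  assumes "decseq w" "finite F"
  shows "sum w F \<le> sum w {..<card F}"
  using assms(2)
proof (induction "card F" arbitrary: F)
  case (Suc n)
  then have ne: "F \<noteq> {}" by auto
  let ?m = "Max F"
  have m: "?m \<in> F" using Suc ne by auto
  have c: "card (F - {?m}) = n" using Suc m by simp
  have "F \<subseteq> {..?m}" using Suc by auto
  then have "card F \<le> Suc ?m" by (metis card_atMost card_mono finite_atMost)
  then have "w ?m \<le> w n" using Suc(2) decseqD[OF assms(1)] by auto
  moreover have "sum w (F - {?m}) \<le> sum w {..<n}" using Suc(1)[of "F - {?m}"] c Suc(3) by simp
  moreover have "sum w F = w ?m + sum w (F - {?m})" using m Suc(3) by (simp add: sum.remove)
  ultimately show ?case by (simp flip: Suc(2))
qed simp

section \<open>Decreasing rearrangement\<close>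

lemma decr_rearr_le:
  assumes "0 < l" "distr_fun x l < enat (Suc k)"
  shows "decr_rearr x k \<le> ennreal l"
  unfolding decr_rearr_def using assms by (intro Inf_lower) auto

lemma le_decr_rearr:
  assumes F: "finite F" "k < card F" "\<And>i. i \<in> F \<Longrightarrow> b \<le> \<bar>x i\<bar>"
  shows "ennreal b \<le> decr_rearr x k"
  unfolding decr_rearr_def
proof (rule Inf_greatest, clarify)
  fix l assume l: "0 < l" "distr_fun x l < enat (Suc k)"
  show "ennreal b \<le> ennreal l"
  proof (rule ccontr)
    assume "\<not> ennreal b \<le> ennreal l"
    then have "l < b" by (metis ennreal_leI not_less)
    then have "F \<subseteq> {k. \<bar>x k\<bar> > l}" using F(3) by force
    moreover have "finite {k. \<bar>x k\<bar> > l}" "card {k. \<bar>x k\<bar> > l} \<le> k"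
      using l(2) by (auto simp: distr_fun_def split: if_splits)
    ultimately show False using card_mono F(2) by (metis le_trans not_le)
  qed
qed

text \<open>Otherwise the level set of \<open>b\<close> lies in \<open>G\<close>, and
  \<open>b\<close> is admissible in the infimum defining \<open>decr_rearr x k\<close>. This is one
  step of a greedy choice of indices.\<close>

lemma ex_fresh_above:
  assumes "finite G" "card G \<le> k" "ennreal b < decr_rearr x k" "0 < b"
  shows "\<exists>i. i \<notin> G \<and> b < \<bar>x i\<bar>"
proof (rule ccontr)
  assume "\<nexists>i. i \<notin> G \<and> b < \<bar>x i\<bar>"
  then have s: "{k. \<bar>x k\<bar> > b} \<subseteq> G" by auto
  then have "finite {k. \<bar>x k\<bar> > b}" "card {k. \<bar>x k\<bar> > b} \<le> k"
    using assms by (auto intro: finite_subset dest: card_mono[rotated])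
  then have "decr_rearr x k \<le> ennreal b"
    using decr_rearr_le[OF assms(4)] by (simp add: distr_fun_def)
  then show False using assms(3) by simp
qed

text \<open>Indices are chosen greedily, each outside the earlier ones. The factor
  \<open>q < 1\<close> is there because \<open>b k\<close> need not be the size of any entry, as for
  positive entries strictly increasing to their supremum.\<close>

lemma ex_inj_near_decr_rearr:
  assumes fin: "\<And>k. decr_rearr x k = ennreal (b k)" and b: "\<And>k. 0 \<le> b k" and q: "0 < q" "q < 1"
  shows "\<exists>\<sigma>. inj_on \<sigma> {..<n} \<and> (\<forall>k<n. q * b k \<le> \<bar>x (\<sigma> k)\<bar>)"
proof (induction n)
  case (Suc n)
  then obtain \<sigma> where \<sigma>: "inj_on \<sigma> {..<n}" "\<And>k. k < n \<Longrightarrow> q * b k \<le> \<bar>x (\<sigma> k)\<bar>" by auto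
  let ?G = "\<sigma> ` {..<n}"
  have "\<exists>i. i \<notin> ?G \<and> q * b n \<le> \<bar>x i\<bar>"
  proof (cases "b n = 0")
    case True
    then show ?thesis using infinite_UNIV_nat ex_new_if_finite[of ?G] by auto
  next
    case False
    then have "0 < b n" using b[of n] by simp
    with q have "0 < q * b n" "q * b n < b n" by auto
    moreover have "card ?G \<le> n" using card_image_le[of "{..<n}" \<sigma>] by simp
    ultimately show ?thesis
      using ex_fresh_above[of ?G n "q * b n" x] fin[of n] b[of n]
      by (auto simp: ennreal_less_iff intro: less_imp_le)
  qed
  then obtain i where i: "i \<notin> ?G" "q * b n \<le> \<bar>x i\<bar>" by auto
  have "inj_on (\<sigma>(n := i)) {..<Suc n}"
    using \<sigma>(1) i(1) by (auto simp: inj_on_def lessThan_Suc)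
  moreover have "\<forall>k<Suc n. q * b k \<le> \<bar>x ((\<sigma>(n := i)) k)\<bar>"
    using \<sigma>(2) i(2) by (auto simp: less_Suc_eq)
  ultimately show ?case by blast
qed auto

section \<open>Weak neighbourhoods and sequences\<close>

text \<open>Eventual membership passes through finite intersections and arbitrary unions, so only
  the generators need checking; there it is convergence along one functional.\<close>

lemma weak_open_eventually:
  assumes "openin (weak_topology_on E N) T" "x \<in> T" "\<And>n. y n \<in> E"
    and "\<And>f. f \<in> bounded_functionals E N \<Longrightarrow> (\<lambda>n. f (y n)) \<longlonglongrightarrow> f x"
  shows "\<forall>\<^sub>F n in sequentially. y n \<in> T"
proof -
  have "generate_topology_on {{x \<in> E. f x \<in> U} | f U. f \<in> bounded_functionals E N \<and> open U} T"
    using assms(1) by (simp add: weak_topology_on_def openin_topology_generated_by_iff)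
  then show ?thesis
    using assms(2)
  proof induction
    case (Int a b)
    then show ?case by (auto intro: eventually_conj)
  next
    case (UN K)
    then obtain k where "k \<in> K" "x \<in> k" by auto
    with UN(2) have "\<forall>\<^sub>F n in sequentially. y n \<in> k" by blast
    then show ?case using \<open>k \<in> K\<close> by (auto elim!: eventually_mono)
  next
    case (Basis s)
    then obtain f U where s: "s = {x \<in> E. f x \<in> U}" "f \<in> bounded_functionals E N" "open U"
      by auto
    then have "\<forall>\<^sub>F n in sequentially. f (y n) \<in> U"
      using Basis assms(4) by (intro topological_tendstoD) auto
    then show ?case by eventually_elim (use s assms(3) in auto)
  qed auto
qed

section \<open>Orlicz functions\<close>

locale orlicz_lorentz =
  fixes \<phi> :: "real \<Rightarrow> real" and w :: "nat \<Rightarrow> real"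
  assumes orlicz: "orlicz_function \<phi>" and weight: "weight_sequence w"
begin

lemma phi_0 [simp]: "\<phi> 0 = 0"
  and phi_pos: "0 < t \<Longrightarrow> 0 < \<phi> t"
  and phi_convex: "convex_on {0..} \<phi>"
  using orlicz by (auto simp: orlicz_function_def)

lemma w_pos: "0 < w k" and w_decseq: "decseq w"
  using weight by (auto simp: weight_sequence_def)

lemma phi_nonneg: "0 \<le> t \<Longrightarrow> 0 \<le> \<phi> t"
  using phi_pos[of t] by (cases "t = 0") auto

text \<open>Convexity on the segment from \<open>0\<close> to \<open>t\<close>, where
  \<open>\<phi> 0 = 0\<close>. Monotonicity and unboundedness follow from it.\<close>

lemma phi_scale: "\<phi> (c * t) \<le> c * \<phi> t" if "0 \<le> c" "c \<le> 1" "0 \<le> t"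
  using convex_onD[OF phi_convex that(1,2), of 0 t] that by simp

lemma phi_mono: "\<phi> s \<le> \<phi> t" if "0 \<le> s" "s \<le> t"
proof (cases "t = 0")
  case False
  then have "\<phi> s \<le> s / t * \<phi> t" using phi_scale[of "s / t" t] that by simp
  also have "\<dots> \<le> 1 * \<phi> t" using that False phi_nonneg[of t] by (intro mult_right_mono) auto
  finally show ?thesis by simp
qed (use that in auto)

lemma phi_strict_mono: "\<phi> s < \<phi> t" if "0 \<le> s" "s < t"
proof -
  have "\<phi> s \<le> s / t * \<phi> t" using phi_scale[of "s / t" t] that by simp
  also have "\<dots> < 1 * \<phi> t" using that phi_pos[of t] by (intro mult_strict_right_mono) auto
  finally show ?thesis by simp
qed

text \<open>A convex function is continuous on an open interval. At \<open>0\<close> the two-sided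
  limit would also involve the arbitrary values at negative arguments.\<close>

lemma phi_isCont: "isCont \<phi> t" if "0 < t"
proof -
  have "convex_on {0<..} \<phi>" using phi_convex by (rule convex_on_subset) auto
  then have "continuous_on {0<..} \<phi>" by (intro convex_on_continuous) auto
  then show ?thesis using that by (simp add: continuous_on_eq_continuous_at)
qed

lemma phi_unbounded: "\<exists>t>0. M < \<phi> t"
proof -
  \<comment> \<open>Convexity gives \<open>\<phi> t \<ge> t * \<phi> 1\<close> for
    \<open>t \<ge> 1\<close>; this \<open>t\<close> makes the right side
    \<open>\<phi> 1 + \<bar>M\<bar> + 1\<close>.\<close>
  define t where "t = 1 + (\<bar>M\<bar> + 1) / \<phi> 1"
  have t: "1 \<le> t" using phi_pos[of 1] by (simp add: t_def)
  have "\<phi> 1 \<le> 1 / t * \<phi> t" using phi_scale[of "1 / t" t] t by simp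
  then have "t * \<phi> 1 \<le> \<phi> t" using t by (simp add: field_simps)
  moreover have "t * \<phi> 1 = \<phi> 1 + \<bar>M\<bar> + 1"
    using phi_pos[of 1] by (simp add: t_def add_divide_distrib distrib_right)
  ultimately show ?thesis using t phi_pos[of 1] by (intro exI[of _ t]) auto
qed

lemma phi_tendsto_scale: "((\<lambda>q. \<phi> (q * b)) \<longlongrightarrow> \<phi> b) (at_left 1)" if "0 \<le> b"
proof (cases "b = 0")
  case False
  then have "isCont \<phi> b" using that phi_isCont by simp
  moreover have "((\<lambda>q. q * b) \<longlongrightarrow> 1 * b) (at_left 1)" by (intro tendsto_intros)
  ultimately show ?thesis using isCont_tendsto_compose[of b \<phi> "\<lambda>q. q * b" "at_left 1"] by simp
qed simp

text \<open>A finite sum passes to the limit as \<open>q\<close> tends to 1 from below. This undoes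
  the loss in \<open>ex_inj_near_decr_rearr\<close> and reaches points of norm exactly 1 from inside
  the ball.\<close>

lemma phi_sum_limit:
  assumes "\<And>q. 0 < q \<Longrightarrow> q < 1 \<Longrightarrow> (\<Sum>k<n. \<phi> (q * b k) * w k) \<le> M" "\<And>k. 0 \<le> b k"
  shows "(\<Sum>k<n::nat. \<phi> (b k) * w k) \<le> M"
proof (rule tendsto_upperbound)
  show "((\<lambda>q. \<Sum>k<n. \<phi> (q * b k) * w k) \<longlongrightarrow> (\<Sum>k<n. \<phi> (b k) * w k)) (at_left 1)"
    by (intro tendsto_intros phi_tendsto_scale assms)
  show "\<forall>\<^sub>F q in at_left 1. (\<Sum>k<n. \<phi> (q * b k) * w k) \<le> M"
    using eventually_at_left_real[OF zero_less_one] by eventually_elim (use assms in auto)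
qed auto

section \<open>The modular as a supremum over injections\<close>

definition modular_le :: "(nat \<Rightarrow> real) \<Rightarrow> real \<Rightarrow> bool" where
  "modular_le x M \<longleftrightarrow> (\<forall>n \<sigma>. inj_on \<sigma> {..<n} \<longrightarrow> (\<Sum>k<n. \<phi> \<bar>x (\<sigma> k)\<bar> * w k) \<le> M)"

text \<open>Remove an index \<open>m\<close> of least absolute value: all \<open>Suc n\<close>
  entries on \<open>F\<close> are at least \<open>\<bar>x m\<bar>\<close> in size, hence so is the
  rearrangement at \<open>n\<close>.\<close>

lemma sum_phi_le_sum_decr_rearr:
  assumes fin: "\<And>k. decr_rearr x k = ennreal (b k)" and b: "\<And>k. 0 \<le> b k" and "finite F"
  shows "(\<Sum>i\<in>F. \<phi> \<bar>x i\<bar>) \<le> (\<Sum>k<card F. \<phi> (b k))"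
  using assms(3)
proof (induction "card F" arbitrary: F)
  case (Suc n)
  then have ne: "F \<noteq> {}" by auto
  obtain m where m: "m \<in> F" "\<And>i. i \<in> F \<Longrightarrow> \<bar>x m\<bar> \<le> \<bar>x i\<bar>"
    using ex_is_arg_min_if_finite[OF Suc(3) ne, of "\<lambda>i. \<bar>x i\<bar>"] by (auto simp: is_arg_min_linorder)
  have c: "card (F - {m}) = n" using Suc m by simp
  have "ennreal \<bar>x m\<bar> \<le> decr_rearr x n"
    using le_decr_rearr[of F n "\<bar>x m\<bar>" x] Suc m by simp
  then have "\<bar>x m\<bar> \<le> b n" using fin b by simp
  then have "\<phi> \<bar>x m\<bar> \<le> \<phi> (b n)" by (intro phi_mono) auto
  moreover have "(\<Sum>i\<in>F - {m}. \<phi> \<bar>x i\<bar>) \<le> (\<Sum>k<n. \<phi> (b k))"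
    using Suc(1)[of "F - {m}"] c Suc(3) by simp
  moreover have "(\<Sum>i\<in>F. \<phi> \<bar>x i\<bar>) = \<phi> \<bar>x m\<bar> + (\<Sum>i\<in>F - {m}. \<phi> \<bar>x i\<bar>)"
    using m Suc(3) by (simp add: sum.remove)
  ultimately show ?case by (simp flip: Suc(2))
qed simp

lemma modular_le_coord: "modular_le x M \<Longrightarrow> \<phi> \<bar>x i\<bar> * w 0 \<le> M"
  unfolding modular_le_def by (drule spec[of _ 1], drule spec[of _ "\<lambda>_. i"]) (simp add: lessThan_Suc)

text \<open>The modular is the supremum of the sums \<open>\<Sum> \<phi>(\<bar>x(\<sigma> k)\<bar>) w(k)\<close> over injections \<open>\<sigma>\<close>; this
  description makes its convexity and its subadditivity on disjoint supports evident.\<close>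

lemma ol_modular_le_iff:
  assumes "0 \<le> M"
  shows "ol_modular \<phi> w x \<le> ennreal M \<longleftrightarrow> modular_le x M"
proof
  assume le: "ol_modular \<phi> w x \<le> ennreal M"
  let ?t = "\<lambda>k. orlicz_ext \<phi> (decr_rearr x k) * ennreal (w k)"
  have part: "sum ?t {..<n} \<le> ennreal M" for n
    using le sum_le_suminf[of ?t "{..<n}"] unfolding ol_modular_def by (auto intro: order_trans)
  have fin: "decr_rearr x k \<noteq> \<infinity>" for k
  proof
    assume "decr_rearr x k = \<infinity>"
    then have "?t k = \<infinity>" using w_pos[of k] by (simp add: orlicz_ext_def ennreal_top_mult)
    moreover have "?t k \<le> sum ?t {..<Suc k}" by (intro member_le_sum) auto
    ultimately show False using part[of "Suc k"] by (simp add: top_unique)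
  qed
  define b where "b k = enn2real (decr_rearr x k)" for k
  have b: "decr_rearr x k = ennreal (b k)" "0 \<le> b k" for k
    using fin[of k] by (auto simp: b_def less_top)
  have t: "?t k = ennreal (\<phi> (b k) * w k)" for k
    using b(2)[of k] w_pos[of k] phi_nonneg[OF b(2)]
    by (simp add: b(1) orlicz_ext_def ennreal_mult')
  show "modular_le x M"
    unfolding modular_le_def
  proof (intro allI impI)
    fix n and \<sigma> :: "nat \<Rightarrow> nat" assume inj: "inj_on \<sigma> {..<n}"
    \<comment> \<open>Summation by parts reduces this to unweighted partial sums, which depend only
      on the image of \<open>\<sigma>\<close> and not on its order.\<close>
    have "(\<Sum>k<n. \<phi> \<bar>x (\<sigma> k)\<bar> * w k) \<le> (\<Sum>k<n. \<phi> (b k) * w k)"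
    proof (rule sum_mult_decseq_mono[OF w_decseq])
      fix m assume "m \<le> n"
      then have inj: "inj_on \<sigma> {..<m}" using inj by (auto intro: inj_on_subset)
      then have "(\<Sum>k<m. \<phi> \<bar>x (\<sigma> k)\<bar>) = (\<Sum>i\<in>\<sigma> ` {..<m}. \<phi> \<bar>x i\<bar>)"
        by (simp add: sum.reindex)
      also have "\<dots> \<le> (\<Sum>k<m. \<phi> (b k))"
        using sum_phi_le_sum_decr_rearr[of x b "\<sigma> ` {..<m}"] b inj by (simp add: card_image)
      finally show "(\<Sum>k<m. \<phi> \<bar>x (\<sigma> k)\<bar>) \<le> (\<Sum>k<m. \<phi> (b k))" .
    qed (use w_pos less_imp_le in auto)
    also have "ennreal (\<Sum>k<n. \<phi> (b k) * w k) \<le> ennreal M"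
      using part[of n] phi_nonneg[OF b(2)] w_pos by (simp add: t less_imp_le)
    then have "(\<Sum>k<n. \<phi> (b k) * w k) \<le> M" using assms by simp
    finally show "(\<Sum>k<n. \<phi> \<bar>x (\<sigma> k)\<bar> * w k) \<le> M" .
  qed
next
  assume le: "modular_le x M"
  \<comment> \<open>Each entry satisfies \<open>\<phi> \<bar>x i\<bar> \<le> M / w 0\<close>, so
    \<open>L\<close> bounds \<open>x\<close> and the rearrangement is finite.\<close>
  obtain L where L: "L > 0" "M / w 0 < \<phi> L" using phi_unbounded by blast
  have bd: "\<bar>x i\<bar> \<le> L" for i
  proof (rule ccontr)
    assume "\<not> \<bar>x i\<bar> \<le> L"
    then have "\<phi> L \<le> \<phi> \<bar>x i\<bar>" using L by (intro phi_mono) auto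
    moreover have "\<phi> \<bar>x i\<bar> \<le> M / w 0"
      using modular_le_coord[OF le] w_pos[of 0] by (simp add: field_simps)
    ultimately show False using L by simp
  qed
  have "decr_rearr x k \<le> ennreal L" for k
  proof (rule decr_rearr_le)
    have "{k. \<bar>x k\<bar> > L} = {}" using bd by (auto simp: not_less)
    then show "distr_fun x L < enat (Suc k)" unfolding distr_fun_def by simp
  qed fact
  then have fin: "decr_rearr x k \<noteq> \<infinity>" for k by (metis ennreal_neq_top infinity_ennreal_def neq_top_trans)
  define b where "b k = enn2real (decr_rearr x k)" for k
  have b: "decr_rearr x k = ennreal (b k)" "0 \<le> b k" for k
    using fin[of k] by (auto simp: b_def less_top)
  have "(\<Sum>k<n. orlicz_ext \<phi> (decr_rearr x k) * ennreal (w k)) \<le> ennreal M" for n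
  proof -
    have "(\<Sum>k<n. \<phi> (b k) * w k) \<le> M"
    proof (rule phi_sum_limit)
      fix q :: real assume q: "0 < q" "q < 1"
      obtain \<sigma> where \<sigma>: "inj_on \<sigma> {..<n}" "\<forall>k<n. q * b k \<le> \<bar>x (\<sigma> k)\<bar>"
        using ex_inj_near_decr_rearr[of x b, OF b q] by blast
      have "(\<Sum>k<n. \<phi> (q * b k) * w k) \<le> (\<Sum>k<n. \<phi> \<bar>x (\<sigma> k)\<bar> * w k)"
        using \<sigma>(2) q b(2) w_pos by (intro sum_mono mult_right_mono phi_mono) (auto simp: less_imp_le)
      also have "\<dots> \<le> M" using le \<sigma>(1) by (simp add: modular_le_def)
      finally show "(\<Sum>k<n. \<phi> (q * b k) * w k) \<le> M" .
    qed fact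
    moreover have "orlicz_ext \<phi> (decr_rearr x k) * ennreal (w k) = ennreal (\<phi> (b k) * w k)" for k
      using b(2)[of k] w_pos[of k] phi_nonneg[OF b(2)]
      by (simp add: b(1) orlicz_ext_def ennreal_mult')
    ultimately show ?thesis using phi_nonneg[OF b(2)] w_pos assms by (simp add: less_imp_le)
  qed
  then show "ol_modular \<phi> w x \<le> ennreal M"
    unfolding ol_modular_def suminf_eq_SUP by (intro SUP_least)
qed

lemma ol_modular_le_1_iff: "ol_modular \<phi> w x \<le> 1 \<longleftrightarrow> modular_le x 1"
  using ol_modular_le_iff[of 1] by simp

lemma modular_leD: "modular_le x M \<Longrightarrow> inj_on \<sigma> {..<n} \<Longrightarrow> (\<Sum>k<n. \<phi> \<bar>x (\<sigma> k)\<bar> * w k) \<le> M"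
  by (simp add: modular_le_def)

lemma modular_le_mono:
  assumes "modular_le x M" "\<And>k. \<bar>y k\<bar> \<le> \<bar>x k\<bar>" "M \<le> M'"
  shows "modular_le y M'"
  unfolding modular_le_def
proof (intro allI impI)
  fix n and \<sigma> :: "nat \<Rightarrow> nat" assume inj: "inj_on \<sigma> {..<n}"
  have "(\<Sum>k<n. \<phi> \<bar>y (\<sigma> k)\<bar> * w k) \<le> (\<Sum>k<n. \<phi> \<bar>x (\<sigma> k)\<bar> * w k)"
    using assms(2) w_pos by (intro sum_mono mult_right_mono phi_mono) (auto simp: less_imp_le)
  with modular_leD[OF assms(1) inj] assms(3) show "(\<Sum>k<n. \<phi> \<bar>y (\<sigma> k)\<bar> * w k) \<le> M'" by simp
qed

lemma modular_le_convex:
  assumes x: "modular_le x M" and y: "modular_le y M'" and "0 \<le> u" "0 \<le> v" "u + v = 1"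
  shows "modular_le (\<lambda>k. u * x k + v * y k) (u * M + v * M')"
  unfolding modular_le_def
proof (intro allI impI)
  fix n and \<sigma> :: "nat \<Rightarrow> nat" assume inj: "inj_on \<sigma> {..<n}"
  have "\<phi> \<bar>u * s + v * t\<bar> \<le> u * \<phi> \<bar>s\<bar> + v * \<phi> \<bar>t\<bar>" for s t
  proof -
    have "\<phi> \<bar>u * s + v * t\<bar> \<le> \<phi> (u * \<bar>s\<bar> + v * \<bar>t\<bar>)"
      using assms by (intro phi_mono) (auto intro!: abs_triangle_ineq[THEN order_trans] simp: abs_mult)
    also have "\<dots> \<le> u * \<phi> \<bar>s\<bar> + v * \<phi> \<bar>t\<bar>"
      using convex_onD[OF phi_convex, of v "\<bar>s\<bar>" "\<bar>t\<bar>"] assms by (simp add: eq_diff_eq[symmetric])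
    finally show ?thesis .
  qed
  then have "(\<Sum>k<n. \<phi> \<bar>u * x (\<sigma> k) + v * y (\<sigma> k)\<bar> * w k)
      \<le> (\<Sum>k<n. (u * \<phi> \<bar>x (\<sigma> k)\<bar> + v * \<phi> \<bar>y (\<sigma> k)\<bar>) * w k)"
    using w_pos by (intro sum_mono mult_right_mono) (auto simp: less_imp_le)
  also have "\<dots> = u * (\<Sum>k<n. \<phi> \<bar>x (\<sigma> k)\<bar> * w k) + v * (\<Sum>k<n. \<phi> \<bar>y (\<sigma> k)\<bar> * w k)"
    by (simp add: sum_distrib_left distrib_right sum.distrib mult.assoc)
  also have "\<dots> \<le> u * M + v * M'"
    using modular_leD[OF x inj] modular_leD[OF y inj] assms by (intro add_mono mult_left_mono) auto
  finally show "(\<Sum>k<n. \<phi> \<bar>u * x (\<sigma> k) + v * y (\<sigma> k)\<bar> * w k) \<le> u * M + v * M'" .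
qed

lemma modular_le_zero: "0 \<le> M \<Longrightarrow> modular_le (\<lambda>k. 0) M"
  by (simp add: modular_le_def)

lemma modular_le_scale:
  "modular_le x M \<Longrightarrow> 0 \<le> c \<Longrightarrow> c \<le> 1 \<Longrightarrow> modular_le (\<lambda>k. c * x k) (c * M)"
  using modular_le_convex[of x M "\<lambda>k. 0" 0 c "1 - c"] by (simp add: modular_le_zero)

lemma modular_le_disjoint_add:
  assumes "modular_le x M" "modular_le y M'" "\<And>k. x k = 0 \<or> y k = 0"
  shows "modular_le (\<lambda>k. x k + y k) (M + M')"
  unfolding modular_le_def
proof (intro allI impI)
  fix n and \<sigma> :: "nat \<Rightarrow> nat" assume inj: "inj_on \<sigma> {..<n}"
  have "\<phi> \<bar>x k + y k\<bar> = \<phi> \<bar>x k\<bar> + \<phi> \<bar>y k\<bar>" for k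
    using assms(3)[of k] by auto
  then show "(\<Sum>k<n. \<phi> \<bar>x (\<sigma> k) + y (\<sigma> k)\<bar> * w k) \<le> M + M'"
    using modular_leD[OF assms(1) inj] modular_leD[OF assms(2) inj]
    by (simp add: distrib_right sum.distrib)
qed

section \<open>The space and its Luxemburg norm\<close>

abbreviation E :: "(nat \<Rightarrow> real) set" where "E \<equiv> ol_space \<phi> w"

abbreviation N :: "(nat \<Rightarrow> real) \<Rightarrow> real" where "N \<equiv> luxemburg_norm \<phi> w"

text \<open>By convexity, dividing by \<open>M + 1\<close> brings a modular of at most
  \<open>M\<close> down to at most \<open>M / (M + 1)\<close>, so finiteness can be replaced by the
  bound 1.\<close>

lemma mem_space_iff: "x \<in> E \<longleftrightarrow> (\<exists>l>0. modular_le (\<lambda>k. l * x k) 1)"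
proof
  assume "x \<in> E"
  then obtain l where l: "l > 0" "ol_modular \<phi> w (\<lambda>k. l * x k) < \<infinity>" by (auto simp: ol_space_def)
  define M where "M = enn2real (ol_modular \<phi> w (\<lambda>k. l * x k))"
  have "0 \<le> M" "modular_le (\<lambda>k. l * x k) M"
    using l(2) by (auto simp: M_def ol_modular_le_iff[symmetric])
  then have "modular_le (\<lambda>k. 1 / (M + 1) * (l * x k)) (1 / (M + 1) * M)"
    by (intro modular_le_scale) auto
  then have "modular_le (\<lambda>k. l / (M + 1) * x k) 1"
    using \<open>0 \<le> M\<close> by (elim modular_le_mono) (auto simp: field_simps)
  then show "\<exists>l>0. modular_le (\<lambda>k. l * x k) 1"
    using l(1) \<open>0 \<le> M\<close> by (intro exI[of _ "l / (M + 1)"]) auto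
next
  assume "\<exists>l>0. modular_le (\<lambda>k. l * x k) 1"
  then obtain l where "l > 0" "ol_modular \<phi> w (\<lambda>k. l * x k) \<le> 1"
    by (auto simp: ol_modular_le_1_iff)
  then show "x \<in> E" by (auto simp: ol_space_def intro!: exI[of _ l] elim: le_less_trans)
qed

lemma modular_le_imp_mem: "modular_le x 1 \<Longrightarrow> x \<in> E"
  unfolding mem_space_iff by (intro exI[of _ 1]) simp

lemma space_scale: "x \<in> E \<Longrightarrow> (\<lambda>k. c * x k) \<in> E"
proof -
  assume "x \<in> E"
  then obtain l where l: "l > 0" "modular_le (\<lambda>k. l * x k) 1" by (auto simp: mem_space_iff)
  \<comment> \<open>The summand 1 in the denominator covers \<open>c = 0\<close>.\<close>
  have "\<bar>l / (\<bar>c\<bar> + 1) * (c * x k)\<bar> \<le> \<bar>l * x k\<bar>" for k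
  proof -
    have "\<bar>c\<bar> / (\<bar>c\<bar> + 1) * \<bar>l * x k\<bar> \<le> 1 * \<bar>l * x k\<bar>" by (intro mult_right_mono) auto
    then show ?thesis using l(1) by (simp add: abs_mult mult_ac)
  qed
  then have "modular_le (\<lambda>k. l / (\<bar>c\<bar> + 1) * (c * x k)) 1" by (rule modular_le_mono[OF l(2)]) simp
  then show ?thesis using l(1) unfolding mem_space_iff by (intro exI[of _ "l / (\<bar>c\<bar> + 1)"]) auto
qed

lemma norm_le: "0 < e \<Longrightarrow> modular_le (\<lambda>k. x k / e) 1 \<Longrightarrow> N x \<le> e"
  unfolding luxemburg_norm_def
  by (intro cInf_lower bdd_belowI[of _ 0]) (auto simp: ol_modular_le_1_iff)

text \<open>On the space, the set whose infimum is the norm is nonempty; the real \<open>Inf\<close>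
  of an empty set would carry no information.\<close>

lemma ex_modular_le_quotient: "x \<in> E \<Longrightarrow> \<exists>e>0. modular_le (\<lambda>k. x k / e) 1"
proof -
  assume "x \<in> E"
  then obtain l where "l > 0" "modular_le (\<lambda>k. l * x k) 1" by (auto simp: mem_space_iff)
  then show ?thesis by (intro exI[of _ "1 / l"]) (simp add: mult.commute)
qed

lemma norm_nonneg: "x \<in> E \<Longrightarrow> 0 \<le> N x"
  unfolding luxemburg_norm_def using ex_modular_le_quotient[of x]
  by (intro cInf_greatest) (auto simp: ol_modular_le_1_iff)

text \<open>The quotient is the convex combination of \<open>x / a\<close> and \<open>y / b\<close>
  with weights \<open>a / (a + b)\<close> and \<open>b / (a + b)\<close>.\<close>

lemma modular_le_add_quotient:
  assumes "0 < a" "0 < b" "modular_le (\<lambda>k. x k / a) 1" "modular_le (\<lambda>k. y k / b) 1"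
  shows "modular_le (\<lambda>k. (x k + y k) / (a + b)) 1"
  using modular_le_convex[OF assms(3,4), of "a / (a + b)" "b / (a + b)"] assms(1,2)
  by (simp add: add_divide_distrib[symmetric])

lemma space_add: "x \<in> E \<Longrightarrow> y \<in> E \<Longrightarrow> (\<lambda>k. x k + y k) \<in> E"
proof -
  assume "x \<in> E" "y \<in> E"
  then obtain a b where "0 < a" "modular_le (\<lambda>k. x k / a) 1" "0 < b" "modular_le (\<lambda>k. y k / b) 1"
    using ex_modular_le_quotient by meson
  from modular_le_add_quotient[OF this(1,3,2,4)] this(1,3) show ?thesis
    unfolding mem_space_iff by (intro exI[of _ "1 / (a + b)"]) simp
qed

text \<open>Strictness provides an admissible \<open>d < e\<close>, and dividing by the larger
  \<open>e\<close> shrinks every entry.\<close>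

lemma norm_lessD:
  assumes "x \<in> E" "N x < e"
  shows "modular_le (\<lambda>k. x k / e) 1"
proof -
  have "{e. 0 < e \<and> modular_le (\<lambda>k. x k / e) 1} \<noteq> {}"
    using ex_modular_le_quotient[OF assms(1)] by auto
  then obtain d where d: "0 < d" "d < e" "modular_le (\<lambda>k. x k / d) 1"
    using cInf_lessD[of "{e. 0 < e \<and> modular_le (\<lambda>k. x k / e) 1}" e] assms(2)
    by (auto simp: luxemburg_norm_def ol_modular_le_1_iff)
  show ?thesis
    by (rule modular_le_mono[OF d(3)]) (use d in \<open>auto intro!: divide_left_mono\<close>)
qed

lemma norm_ge: "x \<in> E \<Longrightarrow> \<not> modular_le (\<lambda>k. x k / e) 1 \<Longrightarrow> e \<le> N x"
  using norm_lessD not_le by blast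

text \<open>The triangle inequality combined with monotonicity in absolute values, so that it
  applies directly to differences and splittings. The slack \<open>e / 2\<close> supplies the strict
  inequalities for \<open>norm_lessD\<close>.\<close>

lemma norm_le_add:
  assumes "x \<in> E" "y \<in> E" "\<And>k. \<bar>z k\<bar> \<le> \<bar>x k\<bar> + \<bar>y k\<bar>"
  shows "N z \<le> N x + N y"
proof (rule field_le_epsilon)
  fix e :: real assume "0 < e"
  define a b where "a = N x + e / 2" and "b = N y + e / 2"
  have pos: "0 < a" "0 < b" using norm_nonneg assms \<open>0 < e\<close> by (auto simp: a_def b_def add_nonneg_pos)
  have "modular_le (\<lambda>k. x k / a) 1" "modular_le (\<lambda>k. y k / b) 1"
    using assms \<open>0 < e\<close> by (auto intro!: norm_lessD simp: a_def b_def)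
  then have "modular_le (\<lambda>k. \<bar>x k\<bar> / a) 1" "modular_le (\<lambda>k. \<bar>y k\<bar> / b) 1"
    by (auto simp: modular_le_def)
  from modular_le_add_quotient[OF pos this] have "modular_le (\<lambda>k. z k / (a + b)) 1"
    by (rule modular_le_mono) (use pos assms(3) in \<open>auto intro!: divide_right_mono\<close>)
  then have "N z \<le> a + b" using pos by (intro norm_le) auto
  then show "N z \<le> N x + N y + e" by (simp add: a_def b_def)
qed

text \<open>Norm at most 1 bounds the modular of \<open>q * x\<close> for each \<open>q < 1\<close>;
  the limit in each finite sum then gives the bound for \<open>x\<close>.\<close>

lemma mem_unit_ball_iff: "x \<in> ol_unit_ball \<phi> w \<longleftrightarrow> modular_le x 1"
proof
  assume "x \<in> ol_unit_ball \<phi> w"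
  then have x: "x \<in> E" "N x \<le> 1" by (auto simp: ol_unit_ball_def)
  show "modular_le x 1"
    unfolding modular_le_def
  proof (intro allI impI, rule phi_sum_limit)
    fix n and \<sigma> :: "nat \<Rightarrow> nat" and q :: real
    assume inj: "inj_on \<sigma> {..<n}" and q: "0 < q" "q < 1"
    have "modular_le (\<lambda>k. q * x k) 1"
    proof -
      have "1 < 1 / q" using q by simp
      then show ?thesis using norm_lessD[OF x(1), of "1 / q"] x(2) by (simp add: mult.commute)
    qed
    from modular_leD[OF this inj] q show "(\<Sum>k<n. \<phi> (q * \<bar>x (\<sigma> k)\<bar>) * w k) \<le> 1"
      by (simp add: abs_mult)
  qed auto
next
  assume "modular_le x 1"
  then show "x \<in> ol_unit_ball \<phi> w"
    using norm_le[of 1 x] by (simp add: ol_unit_ball_def modular_le_imp_mem)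
qed

section \<open>Weakly null sequences\<close>

text \<open>With the signs of \<open>f (v i)\<close> as coefficients, the partial sums of
  \<open>\<bar>f (v i)\<bar>\<close> become values of \<open>f\<close> on the unit ball. They are
  bounded, so the series converges and its terms vanish in the limit.\<close>

lemma functional_tendsto_0:
  assumes f: "f \<in> bounded_functionals E N"
    and v: "\<And>n s. (\<And>i. \<bar>s i\<bar> \<le> 1) \<Longrightarrow> modular_le (\<lambda>k. \<Sum>i<n. s i * v i k) 1"
  shows "(\<lambda>i::nat. f (v i)) \<longlonglongrightarrow> 0"
proof -
  have add: "f (\<lambda>k. x k + y k) = f x + f y" if "x \<in> E" "y \<in> E" for x y
    using f that by (auto simp: bounded_functionals_def)
  have scale: "f (\<lambda>k. c * x k) = c * f x" if "x \<in> E" for c x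
    using f that by (auto simp: bounded_functionals_def)
  obtain C where C: "\<And>x. x \<in> E \<Longrightarrow> \<bar>f x\<bar> \<le> C * N x"
    using f unfolding bounded_functionals_def by blast
  have vE: "v i \<in> E" for i
  proof -
    \<comment> \<open>Coefficients 1 at \<open>i\<close> and 0 elsewhere isolate a single
      \<open>v i\<close>.\<close>
    have "modular_le (\<lambda>k. \<Sum>j<Suc i. (if j = i then 1 else 0) * v j k) 1" by (rule v) auto
    then show ?thesis by (intro modular_le_imp_mem) (simp add: if_distrib[of "\<lambda>c. c * _"] cong: if_cong)
  qed
  define s where "s i = sgn (f (v i))" for i
  have s: "\<bar>s i\<bar> \<le> 1" for i by (simp add: s_def abs_sgn_eq)
  have sumE: "(\<lambda>k. \<Sum>i<n. s i * v i k) \<in> E" for n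
    using v[OF s] by (rule modular_le_imp_mem)
  have "f (\<lambda>k. \<Sum>i<n. s i * v i k) = (\<Sum>i<n. \<bar>f (v i)\<bar>)" for n
  proof (induction n)
    case 0
    \<comment> \<open>The empty sum is the zero sequence, seen as \<open>0\<close> times
      \<open>v 0\<close>.\<close>
    show ?case using scale[OF vE, of 0 0] by simp
  next
    case (Suc n)
    then show ?case
      using add[OF sumE[of n] space_scale[OF vE[of n], of "s n"]] scale[OF vE[of n], of "s n"]
      by (simp add: s_def abs_sgn mult.commute)
  qed
  moreover have "\<bar>f (\<lambda>k. \<Sum>i<n. s i * v i k)\<bar> \<le> \<bar>C\<bar>" for n
  proof -
    have "0 \<le> N (\<lambda>k. \<Sum>i<n. s i * v i k)" "N (\<lambda>k. \<Sum>i<n. s i * v i k) \<le> 1"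
      using norm_nonneg[OF sumE] norm_le[of 1 "\<lambda>k. \<Sum>i<n. s i * v i k"] v[OF s] by auto
    then have "C * N (\<lambda>k. \<Sum>i<n. s i * v i k) \<le> \<bar>C\<bar> * 1" by (intro mult_mono) auto
    then show ?thesis using C[OF sumE[of n]] by simp
  qed
  ultimately have "(\<Sum>i<n. \<bar>f (v i)\<bar>) \<le> \<bar>C\<bar>" for n by (metis abs_le_D1)
  then have "summable (\<lambda>i. \<bar>f (v i)\<bar>)" by (intro summableI_nonneg_bounded) auto
  then show ?thesis using summable_LIMSEQ_zero tendsto_rabs_zero_iff by blast
qed

section \<open>Blocks of small modular and norm close to one\<close>

text \<open>A bound for the dilation \<open>\<rho>\<close> near 0, iterated until
  \<open>\<rho> ^ m\<close> exceeds 2, would give the doubling condition with constant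
  \<open>K ^ m\<close>. Thus doubling fails for factors arbitrarily close to 1 as well.\<close>

lemma not_delta2_zeroD:
  assumes "\<not> delta2_zero \<phi>" "1 < \<rho>" "0 < K" "0 < t0"
  shows "\<exists>t. 0 < t \<and> t \<le> t0 \<and> K * \<phi> t < \<phi> (\<rho> * t)"
proof (rule ccontr)
  assume "\<not> ?thesis"
  then have le: "\<phi> (\<rho> * t) \<le> K * \<phi> t" if "0 \<le> t" "t \<le> t0" for t
    using that by (cases "t = 0") (auto simp: not_less)
  have pow: "\<phi> (\<rho> ^ m * t) \<le> K ^ m * \<phi> t" if "0 \<le> t" "\<rho> ^ m * t \<le> t0" for m t
    using that(2)
  proof (induction m)
    case (Suc m)
    have "\<rho> ^ m * t \<le> \<rho> ^ Suc m * t"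
      using assms(2) that(1) by (intro mult_right_mono power_increasing) auto
    then have le': "\<rho> ^ m * t \<le> t0" using Suc by simp
    have "\<phi> (\<rho> ^ Suc m * t) \<le> K * \<phi> (\<rho> ^ m * t)"
      using le[of "\<rho> ^ m * t"] le' that(1) assms(2) by (simp add: mult.assoc)
    also have "\<dots> \<le> K * (K ^ m * \<phi> t)" using Suc.IH[OF le'] assms(3) by (intro mult_left_mono) auto
    finally show ?case by (simp add: mult.assoc)
  qed simp
  obtain m where m: "2 < \<rho> ^ m" using real_arch_pow[OF assms(2)] by blast
  \<comment> \<open>The range is cut by \<open>\<rho> ^ m\<close> so that all intermediate dilations
    stay below \<open>t0\<close>.\<close>
  have "\<phi> (2 * u) \<le> K ^ m * \<phi> u" if "0 \<le> u" "u \<le> t0 / \<rho> ^ m" for u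
  proof -
    have "\<phi> (2 * u) \<le> \<phi> (\<rho> ^ m * u)" using that m by (intro phi_mono mult_right_mono) auto
    also have "\<dots> \<le> K ^ m * \<phi> u" using that m by (intro pow) (auto simp: field_simps)
    finally show ?thesis .
  qed
  then have "delta2_zero \<phi>"
    unfolding delta2_zero_def using assms m
    by (intro exI[of _ "K ^ m"] exI[of _ "t0 / \<rho> ^ m"] conjI) auto
  then show False using assms(1) by simp
qed

text \<open>The block is made as long as the budget \<open>\<epsilon>\<close> allows. One more
  weight costs at most \<open>\<epsilon> / 2\<close>, so more than \<open>\<epsilon> / 2\<close> is
  used, and the jump of \<open>\<phi>\<close> by the factor \<open>2 / \<epsilon>\<close> lifts this
  above 1.\<close>

lemma ex_block_height_length:
  assumes "\<not> delta2_zero \<phi>" "\<not> summable w" "1 < \<rho>" "0 < \<epsilon>"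
  shows "\<exists>t n. 0 \<le> t \<and> \<phi> t * sum w {..<n} \<le> \<epsilon> \<and> 1 < \<phi> (\<rho> * t) * sum w {..<n}"
proof -
  \<comment> \<open>The bound 1 permits \<open>phi_scale\<close>; the other bound yields
    \<open>\<phi> t * w 0 \<le> \<epsilon> / 2\<close>.\<close>
  define t0 where "t0 = min 1 (\<epsilon> / (2 * w 0 * \<phi> 1))"
  have "0 < t0" using assms w_pos phi_pos[of 1] by (simp add: t0_def)
  then obtain t where t: "0 < t" "t \<le> t0" "2 / \<epsilon> * \<phi> t < \<phi> (\<rho> * t)"
    using not_delta2_zeroD[OF assms(1,3), of "2 / \<epsilon>" t0] assms(4) by auto
  have "\<phi> t \<le> t * \<phi> 1" using phi_scale[of t 1] t by (simp add: t0_def)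
  also have "\<dots> \<le> \<epsilon> / (2 * w 0 * \<phi> 1) * \<phi> 1"
    using t phi_pos[of 1] by (intro mult_right_mono) (auto simp: t0_def)
  finally have small: "\<phi> t * w 0 \<le> \<epsilon> / 2" using w_pos[of 0] phi_pos[of 1] by (simp add: field_simps)
  have "\<exists>n. \<epsilon> / \<phi> t < sum w {..<n}"
  proof (rule ccontr)
    assume "\<not> ?thesis"
    then have "summable w"
      using w_pos by (intro summableI_nonneg_bounded[of _ "\<epsilon> / \<phi> t"]) (auto simp: less_imp_le not_less)
    then show False using assms(2) by simp
  qed
  then have "\<exists>n. \<epsilon> < \<phi> t * sum w {..<n}" using phi_pos[OF t(1)] by (simp add: field_simps)
  \<comment> \<open>\<open>p\<close> is the first length over budget, so its predecessor
    \<open>n\<close> is the last one within it.\<close>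
  then obtain p where p: "\<epsilon> < \<phi> t * sum w {..<p}" "\<And>i. i < p \<Longrightarrow> \<phi> t * sum w {..<i} \<le> \<epsilon>"
    using exists_least_iff[of "\<lambda>n. \<epsilon> < \<phi> t * sum w {..<n}"] by (auto simp: not_less)
  from p(1) assms(4) obtain n where n: "p = Suc n" by (cases p) auto
  have "w n \<le> w 0" using decseqD[OF w_decseq] by simp
  then have "\<phi> t * w n \<le> \<epsilon> / 2" using small phi_nonneg[of t] t by (meson less_imp_le mult_left_mono order_trans)
  then have "\<epsilon> / 2 < \<phi> t * sum w {..<n}" using p(1) by (simp add: n distrib_left)
  then have half: "1 < 2 / \<epsilon> * \<phi> t * sum w {..<n}" using assms(4) by (simp add: field_simps)
  also have "\<dots> \<le> \<phi> (\<rho> * t) * sum w {..<n}"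
    using t(3) w_pos by (intro mult_right_mono sum_nonneg) (auto simp: less_imp_le)
  finally show ?thesis using p(2)[of n] t(1) n by (intro exI[of _ t] exI[of _ n]) auto
qed

text \<open>An injection meets \<open>A\<close> in at most \<open>card A\<close> positions, and the
  first \<open>card A\<close> weights are the largest.\<close>

lemma modular_le_block:
  assumes "finite A" "0 \<le> t"
  shows "modular_le (\<lambda>k. if k \<in> A then t else 0) (\<phi> t * sum w {..<card A})"
  unfolding modular_le_def
proof (intro allI impI)
  fix n and \<sigma> :: "nat \<Rightarrow> nat" assume inj: "inj_on \<sigma> {..<n}"
  let ?F = "{k \<in> {..<n}. \<sigma> k \<in> A}"
  have "card ?F \<le> card A"
    using inj assms(1) by (intro card_inj_on_le[of \<sigma>]) (auto intro: inj_on_subset)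
  then have "sum w {..<card ?F} \<le> sum w {..<card A}"
    using w_pos by (intro sum_mono2) (auto simp: less_imp_le)
  then have "sum w ?F \<le> sum w {..<card A}"
    using sum_decseq_le_sum_lessThan_card[OF w_decseq, of ?F] by simp
  then have "\<phi> t * sum w ?F \<le> \<phi> t * sum w {..<card A}"
    using phi_nonneg[OF assms(2)] by (rule mult_left_mono)
  moreover have "(\<Sum>k<n. \<phi> \<bar>if \<sigma> k \<in> A then t else 0\<bar> * w k) = \<phi> t * sum w ?F"
    using assms(2) unfolding sum_distrib_left
    by (intro sum.mono_neutral_cong_right) auto
  ultimately show "(\<Sum>k<n. \<phi> \<bar>if \<sigma> k \<in> A then t else 0\<bar> * w k) \<le> \<phi> t * sum w {..<card A}"
    by simp
qed

text \<open>Translation by \<open>m\<close> is an injection that puts the block on the first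
  \<open>n\<close> weights.\<close>

lemma not_modular_le_block:
  assumes "M < \<phi> t * sum w {..<n}" "0 \<le> t"
  shows "\<not> modular_le (\<lambda>k. if k \<in> {m..<m + n} then t else 0) M"
proof
  assume "modular_le (\<lambda>k. if k \<in> {m..<m + n} then t else 0) M"
  from modular_leD[OF this, of "\<lambda>k. m + k" n] assms show False
    by (simp add: sum_distrib_left)
qed

section \<open>Diameter two when doubling fails\<close>

abbreviation ball_topology :: "(nat \<Rightarrow> real) topology" where
  "ball_topology \<equiv> subtopology (weak_topology_on E N) (ol_unit_ball \<phi> w)"

lemma norm_diameter_le_2:
  assumes "S \<subseteq> ol_unit_ball \<phi> w"
  shows "norm_diameter N S \<le> 2"
  unfolding norm_diameter_def
proof (rule SUP_least, clarify)
  fix y z assume "y \<in> S" "z \<in> S"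
  then have "y \<in> E" "z \<in> E" "N y \<le> 1" "N z \<le> 1" using assms by (auto simp: ol_unit_ball_def)
  then show "ereal (N (\<lambda>k. y k - z k)) \<le> 2"
    using norm_le_add[of y z "\<lambda>k. y k - z k"] abs_triangle_ineq4 by fastforce
qed

lemma norm_diameter_weakly_open:
  assumes nd: "\<not> delta2_zero \<phi>" "\<not> summable w" and S: "S \<noteq> {}" "openin ball_topology S"
  shows "norm_diameter N S = 2"
proof (rule antisym)
  obtain T where T: "openin (weak_topology_on E N) T" "S = T \<inter> ol_unit_ball \<phi> w"
    using S(2) by (auto simp: openin_subtopology)
  then show "norm_diameter N S \<le> 2" by (intro norm_diameter_le_2) auto
  \<comment> \<open>The distances found below are at least \<open>2 / \<rho> i\<close>, which tends
    to 2.\<close>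
  define \<rho> where "\<rho> i = 1 + inverse (real (Suc i))" for i
  have \<rho>: "1 < \<rho> i" for i by (simp add: \<rho>_def)
  \<comment> \<open>These budgets have all partial sums below 1, which keeps every signed sum of
    blocks in the ball.\<close>
  have "\<exists>t n. 0 \<le> t \<and> \<phi> t * sum w {..<n} \<le> (1/2) ^ Suc i \<and> 1 < \<phi> (\<rho> i * t) * sum w {..<n}" for i
    by (rule ex_block_height_length[OF nd \<rho>]) simp
  then obtain t n where tn: "\<And>i. 0 \<le> t i" "\<And>i. \<phi> (t i) * sum w {..<n i} \<le> (1/2) ^ Suc i"
      "\<And>i. 1 < \<phi> (\<rho> i * t i) * sum w {..<n i}"
    by metis
  \<comment> \<open>The blocks are laid end to end, block \<open>i\<close> starting at
    \<open>m i\<close>.\<close>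
  define m where "m i = sum n {..<i}" for i
  define A where "A i = {m i..<m i + n i}" for i
  have disj: "i = j" if "k \<in> A i" "k \<in> A j" for i j k
  proof -
    have "m i + n i \<le> m j" if "i < j" for i j
    proof -
      have "sum n {..<Suc i} \<le> sum n {..<j}" using that by (intro sum_mono2) auto
      then show ?thesis by (simp add: m_def)
    qed
    from this[of i j] this[of j i] that show ?thesis by (cases i j rule: linorder_cases) (auto simp: A_def)
  qed
  define u where "u i = (\<lambda>k. if k \<in> A i then t i else 0)" for i
  have u_mod: "modular_le (u i) ((1/2) ^ Suc i)" for i
    unfolding u_def using modular_le_block[of "A i" "t i"] tn(1,2)[of i]
    by (auto simp: A_def elim!: modular_le_mono)
  have u_sum: "modular_le (\<lambda>k. \<Sum>i<p. s i * u i k) 1" if s: "\<And>i. \<bar>s i\<bar> \<le> 1" for s p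
  proof -
    \<comment> \<open>The sharper bound is the sum of the first \<open>p\<close> budgets, which
      makes the induction close.\<close>
    have "modular_le (\<lambda>k. \<Sum>i<p. s i * u i k) (1 - (1/2) ^ p)"
    proof (induction p)
      case (Suc p)
      have "\<bar>s p * u p k\<bar> \<le> \<bar>u p k\<bar>" for k
        using mult_right_mono[OF s[of p], of "\<bar>u p k\<bar>"] by (simp add: abs_mult)
      then have "modular_le (\<lambda>k. s p * u p k) ((1/2) ^ Suc p)" by (rule modular_le_mono[OF u_mod]) simp
      moreover have "(\<Sum>i<p. s i * u i k) = 0 \<or> s p * u p k = 0" for k
      proof (cases "k \<in> A p")
        case True
        then have "k \<notin> A i" if "i < p" for i using disj that by blast
        then show ?thesis by (simp add: u_def)
      qed (simp add: u_def)
      ultimately have "modular_le (\<lambda>k. (\<Sum>i<p. s i * u i k) + s p * u p k) (1 - (1/2) ^ p + (1/2) ^ Suc p)"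
        by (intro modular_le_disjoint_add Suc)
      then show ?case by simp
    qed (simp add: modular_le_zero)
    then show ?thesis by (rule modular_le_mono) auto
  qed
  have uE: "u i \<in> E" for i
    by (rule modular_le_imp_mem, rule modular_le_mono[OF u_mod[of i]], simp, rule power_le_one) auto
  obtain x where x: "x \<in> T" "modular_le x 1" using S(1) T(2) by (auto simp: mem_unit_ball_iff)
  \<comment> \<open>Shrinking \<open>x\<close> slightly stays in \<open>T\<close> and leaves modular
    at most \<open>q < 1\<close>, so there is room \<open>1 - q\<close> for a block.\<close>
  have "\<forall>\<^sub>F j in sequentially. (\<lambda>k. (1 - inverse (real (Suc j))) * x k) \<in> T"
  proof (rule weak_open_eventually[OF T(1) x(1)])
    show "(\<lambda>k. (1 - inverse (real (Suc j))) * x k) \<in> E" for j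
      using x(2) by (intro space_scale modular_le_imp_mem)
    fix f assume f: "f \<in> bounded_functionals E N"
    then have eq: "f (\<lambda>k. c * x k) = c * f x" for c
      using modular_le_imp_mem[OF x(2)] by (auto simp: bounded_functionals_def)
    have "(\<lambda>j. (1 - inverse (real (Suc j))) * f x) \<longlonglongrightarrow> (1 - 0) * f x"
      by (intro tendsto_intros LIMSEQ_inverse_real_of_nat)
    then show "(\<lambda>j. f (\<lambda>k. (1 - inverse (real (Suc j))) * x k)) \<longlonglongrightarrow> f x" unfolding eq by simp
  qed
  then obtain j where j: "(\<lambda>k. (1 - inverse (real (Suc j))) * x k) \<in> T"
    using eventually_happens'[OF sequentially_bot] by blast
  define q where "q = 1 - inverse (real (Suc j))"
  have q: "0 \<le> q" "q < 1" by (auto simp: q_def inverse_le_1_iff)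
  define x' where "x' = (\<lambda>k. q * x k)"
  have x'T: "x' \<in> T" using j by (simp add: x'_def q_def)
  have x': "modular_le x' q" using modular_le_scale[OF x(2), of q] q by (simp add: x'_def)
  then have x'1: "modular_le x' 1" by (rule modular_le_mono) (use q in auto)
  \<comment> \<open>\<open>v i\<close> is the piece of \<open>x'\<close> that block \<open>i\<close>
    replaces. Signed sums of these pieces are dominated by \<open>x'\<close>, so they are weakly
    null too.\<close>
  define v where "v i = (\<lambda>k. if k \<in> A i then x' k else 0)" for i
  have v_sum: "modular_le (\<lambda>k. \<Sum>i<p. s i * v i k) 1" if s: "\<And>i. \<bar>s i\<bar> \<le> 1" for s p
  proof (rule modular_le_mono[OF x'1])
    fix k
    show "\<bar>\<Sum>i<p. s i * v i k\<bar> \<le> \<bar>x' k\<bar>"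
    proof (cases "\<exists>i<p. k \<in> A i")
      case True
      then obtain i where i: "i < p" "k \<in> A i" by auto
      have "(\<Sum>j<p. s j * v j k) = (\<Sum>j<p. if j = i then s i * x' k else 0)"
        using i disj by (intro sum.cong) (auto simp: v_def)
      also have "\<dots> = s i * x' k" using i by simp
      finally show ?thesis using mult_right_mono[OF s[of i], of "\<bar>x' k\<bar>"] by (simp add: abs_mult)
    next
      case False
      then have "(\<Sum>j<p. s j * v j k) = 0" by (intro sum.neutral) (auto simp: v_def)
      then show ?thesis by simp
    qed
  qed simp
  have vE: "v i \<in> E" for i
    by (rule modular_le_imp_mem, rule modular_le_mono[OF x'1]) (auto simp: v_def)
  define y where "y c i = (\<lambda>k. if k \<in> A i then c * t i else x' k)" for c i
  \<comment> \<open>In this form the weak limit of \<open>y c i\<close> is visibly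
    \<open>x'\<close>.\<close>
  have y_eq: "y c i = (\<lambda>k. x' k + (c * u i k + -1 * v i k))" for c i
    by (auto simp: y_def u_def v_def)
  have yE: "y c i \<in> E" for c i
    unfolding y_eq using modular_le_imp_mem[OF x'1] uE vE by (intro space_add space_scale)
  have y_T: "\<forall>\<^sub>F i in sequentially. y c i \<in> T" for c
  proof (rule weak_open_eventually[OF T(1) x'T yE])
    fix f assume f: "f \<in> bounded_functionals E N"
    have "f (y c i) = f x' + (c * f (u i) + -1 * f (v i))" for i
    proof -
      have "f (y c i) = f x' + f (\<lambda>k. c * u i k + -1 * v i k)"
        unfolding y_eq using f modular_le_imp_mem[OF x'1] uE vE
        by (auto simp only: bounded_functionals_def mem_Collect_eq space_add space_scale)
      also have "f (\<lambda>k. c * u i k + -1 * v i k) = f (\<lambda>k. c * u i k) + f (\<lambda>k. -1 * v i k)"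
        using f uE vE by (auto simp only: bounded_functionals_def mem_Collect_eq space_scale)
      also have "\<dots> = c * f (u i) + -1 * f (v i)"
        using f uE vE by (auto simp only: bounded_functionals_def mem_Collect_eq)
      finally show ?thesis .
    qed
    moreover have "(\<lambda>i. f x' + (c * f (u i) + -1 * f (v i))) \<longlonglongrightarrow> f x' + (c * 0 + -1 * 0)"
      by (intro tendsto_intros functional_tendsto_0[OF f u_sum] functional_tendsto_0[OF f v_sum])
    ultimately show "(\<lambda>i. f (y c i)) \<longlonglongrightarrow> f x'" by simp
  qed
  have y_mod: "modular_le (y c i) 1" if c: "\<bar>c\<bar> = 1" and i: "(1/2) ^ Suc i \<le> 1 - q" for c i
  proof -
    have "modular_le (\<lambda>k. if k \<in> A i then 0 else x' k) q"
      by (rule modular_le_mono[OF x']) auto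
    moreover have "modular_le (\<lambda>k. c * u i k) ((1/2) ^ Suc i)"
      by (rule modular_le_mono[OF u_mod]) (use c in \<open>auto simp: abs_mult\<close>)
    ultimately have "modular_le (\<lambda>k. (if k \<in> A i then 0 else x' k) + c * u i k) (q + (1/2) ^ Suc i)"
      by (rule modular_le_disjoint_add) (auto simp: u_def)
    then show ?thesis
      by (rule modular_le_mono) (use i in \<open>auto simp: y_def u_def\<close>)
  qed
  have N_diff: "2 / \<rho> i \<le> N (\<lambda>k. y 1 i k - y (-1) i k)" for i
  proof -
    \<comment> \<open>The common part cancels. Dividing by \<open>2 / \<rho> i\<close> gives the
      block of height \<open>\<rho> i * t i\<close>, whose modular exceeds 1.\<close>
    have eq: "y 1 i k - y (-1) i k = 2 * u i k" for k by (simp add: y_def u_def)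
    have "\<not> modular_le (\<lambda>k. if k \<in> A i then \<rho> i * t i else 0) 1"
      unfolding A_def using not_modular_le_block[OF tn(3)[of i]] tn(1)[of i] \<rho>[of i] by simp
    moreover have "(\<lambda>k. if k \<in> A i then \<rho> i * t i else 0) = (\<lambda>k. 2 * u i k / (2 / \<rho> i))"
      by (auto simp: u_def)
    ultimately show ?thesis
      unfolding eq using uE by (intro norm_ge space_scale) auto
  qed
  have "(\<lambda>i. (1/2 :: real) ^ Suc i) \<longlonglongrightarrow> 0"
    by (intro LIMSEQ_Suc LIMSEQ_realpow_zero) auto
  then have "\<forall>\<^sub>F i in sequentially. (1/2) ^ Suc i < 1 - q"
    by (rule order_tendstoD) (use q in simp)
  with y_T[of 1] y_T[of "-1"]
  have ev: "\<forall>\<^sub>F i in sequentially. ereal (2 / \<rho> i) \<le> norm_diameter N S"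
  proof eventually_elim
    case (elim i)
    then have "y 1 i \<in> S" "y (-1) i \<in> S" using y_mod by (auto simp: T(2) mem_unit_ball_iff)
    then have "ereal (N (\<lambda>k. y 1 i k - y (-1) i k)) \<le> norm_diameter N S"
      unfolding norm_diameter_def by (intro SUP_upper2[of "(y 1 i, y (-1) i)"]) auto
    then show ?case using N_diff[of i] by (meson ereal_less_eq(3) order_trans)
  qed
  have "(\<lambda>i. 2 / \<rho> i) \<longlonglongrightarrow> 2 / (1 + 0)"
    unfolding \<rho>_def by (intro tendsto_intros LIMSEQ_inverse_real_of_nat) auto
  then have "(\<lambda>i. ereal (2 / \<rho> i)) \<longlonglongrightarrow> ereal 2" by simp
  then show "2 \<le> norm_diameter N S"
    using tendsto_upperbound[OF _ ev] by simp
qed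

section \<open>A weakly open set of small diameter under doubling\<close>

lemma phi_surj: "0 < s \<Longrightarrow> \<exists>c>0. \<phi> c = s"
proof -
  assume s: "0 < s"
  \<comment> \<open>A positive left endpoint with \<open>\<phi> a \<le> s\<close>, because
    \<open>phi_isCont\<close> speaks only of positive arguments.\<close>
  define a where "a = min 1 (s / \<phi> 1)"
  have a: "0 < a" "a \<le> 1" using s phi_pos[of 1] by (auto simp: a_def)
  have "\<phi> a \<le> a * \<phi> 1" using phi_scale[of a 1] a by simp
  also have "\<dots> \<le> s / \<phi> 1 * \<phi> 1" using phi_pos[of 1] by (intro mult_right_mono) (auto simp: a_def)
  finally have "\<phi> a \<le> s" using phi_pos[of 1] by simp
  moreover obtain b where b: "0 < b" "s < \<phi> b" using phi_unbounded by blast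
  moreover have "a \<le> b" using phi_mono[of b a] b \<open>\<phi> a \<le> s\<close> by linarith
  moreover have "continuous_on {a..b} \<phi>" using a phi_isCont by (intro continuous_at_imp_continuous_on) auto
  ultimately obtain c where "a \<le> c" "\<phi> c = s" using IVT'[of \<phi> a s b] by auto
  then show ?thesis using a by (intro exI[of _ c]) auto
qed

text \<open>If \<open>\<phi> c * w 0 = 1\<close>, then no entry of a point of the ball exceeds
  \<open>c\<close> in absolute value. This makes the slice used below weakly open.\<close>

lemma coordinate_bounded_functional: "(\<lambda>x. x 0) \<in> bounded_functionals E N"
proof -
  obtain c where c: "0 < c" "\<phi> c = 1 / w 0" using phi_surj[of "1 / w 0"] w_pos by auto
  have "\<bar>x 0\<bar> \<le> c * N x" if "x \<in> E" for x
  proof -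
    have "\<bar>x 0\<bar> / c \<le> N x"
    proof (rule dense_ge)
      fix e assume e: "N x < e"
      then have "0 < e" using norm_nonneg[OF that] by simp
      have "\<phi> \<bar>x 0 / e\<bar> * w 0 \<le> 1" using modular_le_coord[OF norm_lessD[OF that e], of 0] by simp
      then have "\<phi> \<bar>x 0 / e\<bar> \<le> \<phi> c" unfolding c(2) pos_le_divide_eq[OF w_pos] .
      then have "\<bar>x 0 / e\<bar> \<le> c" using phi_strict_mono[of c "\<bar>x 0 / e\<bar>"] c(1) by linarith
      then show "\<bar>x 0\<bar> / c \<le> e" using \<open>0 < e\<close> c(1) by (simp add: field_simps)
    qed
    then show ?thesis using c(1) by (simp add: field_simps)
  qed
  then show ?thesis unfolding bounded_functionals_def by blast
qed

text \<open>The leading entry already uses up nearly all of the modular, with the largest weight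
  \<open>w(0)\<close>; so the modular of the rest with respect to the shifted weight is at most \<open>\<eta>\<close>.\<close>

lemma modular_le_tail:
  assumes y: "modular_le y 1" and lead: "1 - \<eta> \<le> \<phi> \<bar>y 0\<bar> * w 0"
  shows "i \<noteq> 0 \<Longrightarrow> \<phi> \<bar>y i\<bar> * w 1 \<le> \<eta>"
    and "modular_le (y(0 := 0)) (w 0 / w 1 * \<eta> + \<eta>)"
proof -
  have single: "\<phi> \<bar>y i\<bar> * w 1 \<le> \<eta>" if "i \<noteq> 0" for i
  proof -
    \<comment> \<open>Entries 0 and \<open>i\<close> take the two largest weights.\<close>
    have "inj_on (\<lambda>k. if k = 0 then 0 else i) {..<2::nat}" using that by (auto simp: inj_on_def)
    from modular_leD[OF y this] lead show ?thesis by (simp add: numeral_2_eq_2)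
  qed
  then show "i \<noteq> 0 \<Longrightarrow> \<phi> \<bar>y i\<bar> * w 1 \<le> \<eta>" .
  have "0 \<le> \<phi> \<bar>y 1\<bar> * w 1" using phi_nonneg[of "\<bar>y 1\<bar>"] w_pos[of 1] by simp
  then have \<eta>: "0 \<le> \<eta>" using single[of 1] by simp
  show "modular_le (y(0 := 0)) (w 0 / w 1 * \<eta> + \<eta>)"
    unfolding modular_le_def
  proof (intro allI impI)
    fix n and \<sigma> :: "nat \<Rightarrow> nat" assume inj: "inj_on \<sigma> {..<n}"
    let ?y = "y(0 := 0)"
    show "(\<Sum>k<n. \<phi> \<bar>?y (\<sigma> k)\<bar> * w k) \<le> w 0 / w 1 * \<eta> + \<eta>"
    proof (cases n)
      case 0
      then show ?thesis using \<eta> w_pos by (simp add: less_imp_le)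
    next
      case (Suc p)
      \<comment> \<open>Index 0 moves to the front. If \<open>\<sigma>\<close> used it elsewhere,
        that position receives \<open>\<sigma> 0\<close> instead, which keeps the map
        injective.\<close>
      define \<tau> where "\<tau> k = (if k = 0 then 0 else if \<sigma> k = 0 then \<sigma> 0 else \<sigma> k)" for k
      have "inj_on \<tau> {..<n}"
      proof (rule inj_onI)
        fix i j assume ij: "i \<in> {..<n}" "j \<in> {..<n}" "\<tau> i = \<tau> j"
        have "0 \<in> {..<n}" using Suc by simp
        with ij show "i = j"
          using inj_onD[OF inj, of i j] inj_onD[OF inj, of i 0] inj_onD[OF inj, of j 0]
          by (auto simp: \<tau>_def split: if_splits)
      qed
      from modular_leD[OF y this]
      have "\<phi> \<bar>y 0\<bar> * w 0 + (\<Sum>k<p. \<phi> \<bar>y (\<tau> (Suc k))\<bar> * w (Suc k)) \<le> 1"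
        unfolding Suc sum.lessThan_Suc_shift by (simp add: \<tau>_def)
      then have "(\<Sum>k<p. \<phi> \<bar>y (\<tau> (Suc k))\<bar> * w (Suc k)) \<le> \<eta>" using lead by simp
      moreover have "(\<Sum>k<p. \<phi> \<bar>?y (\<sigma> (Suc k))\<bar> * w (Suc k)) \<le> (\<Sum>k<p. \<phi> \<bar>y (\<tau> (Suc k))\<bar> * w (Suc k))"
        using w_pos phi_nonneg by (intro sum_mono mult_right_mono) (auto simp: \<tau>_def less_imp_le)
      \<comment> \<open>The entry displaced from the front is bounded on its own, at the cost of the
        ratio of the first two weights.\<close>
      moreover have "\<phi> \<bar>?y (\<sigma> 0)\<bar> * w 0 \<le> w 0 / w 1 * \<eta>"
      proof -
        have "\<phi> \<bar>?y (\<sigma> 0)\<bar> * w 1 \<le> \<eta>" using single[of "\<sigma> 0"] \<eta> by (cases "\<sigma> 0 = 0") auto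
        then have "w 0 / w 1 * (\<phi> \<bar>?y (\<sigma> 0)\<bar> * w 1) \<le> w 0 / w 1 * \<eta>"
          using w_pos by (intro mult_left_mono) (auto simp: less_imp_le)
        then show ?thesis using w_pos[of 1] by (simp add: mult_ac)
      qed
      ultimately show ?thesis unfolding Suc sum.lessThan_Suc_shift by simp
    qed
  qed
qed

lemma ex_small_slice:
  assumes "delta2_zero \<phi>"
  shows "\<exists>S. S \<noteq> {} \<and> openin ball_topology S \<and> norm_diameter N S \<noteq> 2"
proof -
  obtain K u0 where K: "0 < K" "0 < u0" "\<And>u. 0 \<le> u \<Longrightarrow> u \<le> u0 \<Longrightarrow> \<phi> (2 * u) \<le> K * \<phi> u"
    using assms by (auto simp: delta2_zero_def)
  define R where "R = w 0 / w 1 + 1"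
  have R: "0 < R" using w_pos[of 0] w_pos[of 1] by (simp add: R_def add_pos_pos)
  \<comment> \<open>The tail has modular at most \<open>R * \<eta>\<close>. The first bound absorbs
    the factor from two doublings; the second keeps tail entries below \<open>u0 / 2\<close>, where
    both doublings are allowed.\<close>
  define \<eta> where "\<eta> = min (1 / (K\<^sup>2 * R)) (\<phi> (u0 / 2) * w 1 / 2)"
  have \<eta>: "0 < \<eta>" "\<eta> * R * K\<^sup>2 \<le> 1" "\<eta> < \<phi> (u0 / 2) * w 1"
  proof -
    have pos: "0 < \<phi> (u0 / 2) * w 1" using K w_pos phi_pos[of "u0 / 2"] by simp
    then show "0 < \<eta>" "\<eta> < \<phi> (u0 / 2) * w 1" using K R by (auto simp: \<eta>_def min_less_iff_disj mult.commute)
    have "\<eta> * (R * K\<^sup>2) \<le> 1 / (K\<^sup>2 * R) * (R * K\<^sup>2)"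
      using K R by (intro mult_right_mono) (auto simp: \<eta>_def)
    then show "\<eta> * R * K\<^sup>2 \<le> 1" using K R by (simp add: field_simps)
  qed
  obtain c where c: "0 < c" "\<phi> c = 1 / w 0" using phi_surj[of "1 / w 0"] w_pos by auto
  \<comment> \<open>A leading entry above \<open>q * c\<close> must use modular at least
    \<open>1 - \<eta>\<close>; \<open>q > 1/2\<close> confines these entries to an interval of
    length below \<open>c / 2\<close>.\<close>
  have "\<forall>\<^sub>F q in at_left 1. (1 - \<eta>) / w 0 < \<phi> (q * c)"
    using phi_tendsto_scale[of c] c \<eta>(1) w_pos[of 0]
    by (intro order_tendstoD) (auto simp: divide_strict_right_mono)
  moreover have "\<forall>\<^sub>F q in at_left 1. q \<in> {1/2<..<1::real}" by (intro eventually_at_left_real) simp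
  ultimately have "\<forall>\<^sub>F q in at_left (1::real). q \<in> {1/2<..<1} \<and> (1 - \<eta>) / w 0 < \<phi> (q * c)"
    by eventually_elim auto
  then obtain q where q: "1/2 < q" "q < 1" "(1 - \<eta>) / w 0 < \<phi> (q * c)"
    using eventually_happens'[OF trivial_limit_at_left_real] by force
  define S where "S = {y \<in> E. y 0 \<in> {q * c<..}} \<inter> ol_unit_ball \<phi> w"
  have lead: "q * c < y 0" "y 0 \<le> c" and N_tail: "N (y(0 := 0)) \<le> 1/4" "y(0 := 0) \<in> E" if "y \<in> S" for y
  proof -
    show y0: "q * c < y 0" using that by (simp add: S_def)
    have y: "modular_le y 1" using that by (simp add: S_def mem_unit_ball_iff)
    have "\<phi> \<bar>y 0\<bar> \<le> \<phi> c" using modular_le_coord[OF y, of 0] unfolding c(2) pos_le_divide_eq[OF w_pos] .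
    then show "y 0 \<le> c" using phi_strict_mono[of c "\<bar>y 0\<bar>"] c(1) by linarith
    have "\<phi> (q * c) \<le> \<phi> \<bar>y 0\<bar>" using y0 q c by (intro phi_mono) auto
    then have "1 - \<eta> \<le> \<phi> \<bar>y 0\<bar> * w 0"
      using order_less_le_trans[OF q(3)] w_pos[of 0] by (fastforce simp: pos_divide_less_eq)
    note tail = modular_le_tail[OF y this]
    let ?y = "y(0 := 0)"
    have four: "\<phi> \<bar>4 * ?y i\<bar> \<le> K\<^sup>2 * \<phi> \<bar>?y i\<bar>" for i
    proof (cases "i = 0")
      case False
      then have "\<phi> \<bar>y i\<bar> * w 1 < \<phi> (u0 / 2) * w 1" using tail(1)[of i] \<eta>(3) by simp
      then have "\<phi> \<bar>y i\<bar> < \<phi> (u0 / 2)" using w_pos[of 1] by simp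
      then have small: "\<bar>y i\<bar> \<le> u0 / 2" using phi_mono[of "u0 / 2" "\<bar>y i\<bar>"] K(2) by linarith
      have "\<phi> (2 * (2 * \<bar>y i\<bar>)) \<le> K * \<phi> (2 * \<bar>y i\<bar>)" using small by (intro K) auto
      also have "\<dots> \<le> K * (K * \<phi> \<bar>y i\<bar>)" using small K by (intro mult_left_mono K) auto
      finally show ?thesis using False by (simp add: power2_eq_square abs_mult mult.assoc)
    qed simp
    have four_mod: "modular_le (\<lambda>k. 4 * ?y k) 1"
      unfolding modular_le_def
    proof (intro allI impI)
      fix n and \<sigma> :: "nat \<Rightarrow> nat" assume inj: "inj_on \<sigma> {..<n}"
      have "(\<Sum>k<n. \<phi> \<bar>4 * ?y (\<sigma> k)\<bar> * w k) \<le> (\<Sum>k<n. K\<^sup>2 * \<phi> \<bar>?y (\<sigma> k)\<bar> * w k)"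
        using w_pos four by (intro sum_mono mult_right_mono) (auto simp: less_imp_le)
      also have "\<dots> = K\<^sup>2 * (\<Sum>k<n. \<phi> \<bar>?y (\<sigma> k)\<bar> * w k)" by (simp add: sum_distrib_left mult.assoc)
      also have "\<dots> \<le> K\<^sup>2 * (w 0 / w 1 * \<eta> + \<eta>)"
        using modular_leD[OF tail(2) inj] by (intro mult_left_mono) auto
      also have "\<dots> \<le> 1" using \<eta>(2) by (simp add: R_def algebra_simps)
      finally show "(\<Sum>k<n. \<phi> \<bar>4 * ?y (\<sigma> k)\<bar> * w k) \<le> 1" .
    qed
    then show "N ?y \<le> 1/4" by (intro norm_le) (auto simp: mult.commute)
    show "?y \<in> E" using four_mod unfolding mem_space_iff by (intro exI[of _ 4]) auto
  qed
  have "norm_diameter N S \<le> 1"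
    unfolding norm_diameter_def
  proof (rule SUP_least, clarify)
    fix y z assume yz: "y \<in> S" "z \<in> S"
    \<comment> \<open>The difference splits into its leading entry, of norm at most 1/2, and two
      tails of norm at most 1/4 each.\<close>
    define d where "d = (\<lambda>k::nat. if k \<in> {0} then y 0 - z 0 else 0)"
    have "\<bar>y 0 - z 0\<bar> \<le> c / 2"
    proof -
      have "1/2 * c < q * c" using q c by (intro mult_strict_right_mono) auto
      then show ?thesis using lead[OF yz(1)] lead[OF yz(2)] by linarith
    qed
    moreover have "modular_le (\<lambda>k::nat. if k \<in> {0} then c else 0) 1"
      using modular_le_block[of "{0}" c] c w_pos[of 0] by simp
    ultimately have d: "modular_le (\<lambda>k. d k / (1/2)) 1"
      by (elim modular_le_mono) (auto simp: d_def abs_if)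
    have dN: "N d \<le> 1/2" by (rule norm_le) (use d in auto)
    have dE: "d \<in> E" unfolding mem_space_iff using d by (intro exI[of _ 2]) (simp add: mult.commute)
    define e where "e = (\<lambda>k. (y(0 := 0)) k + (-1) * (z(0 := 0)) k)"
    have eE: "e \<in> E" unfolding e_def using N_tail(2) yz by (intro space_add space_scale)
    have "N e \<le> N (y(0 := 0)) + N (z(0 := 0))"
      using N_tail(2) yz by (intro norm_le_add) (auto simp: e_def)
    moreover have "N (\<lambda>k. y k - z k) \<le> N d + N e"
      using dE eE by (intro norm_le_add) (auto simp: d_def e_def)
    ultimately show "ereal (N (\<lambda>k. y k - z k)) \<le> 1"
      using dN N_tail(1)[OF yz(1)] N_tail(1)[OF yz(2)] by simp
  qed
  then have "norm_diameter N S \<noteq> 2" by auto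
  \<comment> \<open>The single entry \<open>c\<close> has modular exactly 1 and exceeds
    \<open>q * c\<close>, so the slice is nonempty.\<close>
  moreover have "(\<lambda>k. if k \<in> {0} then c else 0) \<in> S"
    using modular_le_block[of "{0}" c] c w_pos[of 0] q
    by (auto simp: S_def mem_unit_ball_iff modular_le_imp_mem)
  moreover have "openin (weak_topology_on E N) {y \<in> E. y 0 \<in> {q * c<..}}"
    unfolding weak_topology_on_def openin_topology_generated_by_iff
  proof (rule generate_topology_on.Basis, rule CollectI, intro exI conjI)
    show "{y \<in> E. y 0 \<in> {q * c<..}} = {y \<in> E. (\<lambda>x. x 0) y \<in> {q * c<..}}" ..
  qed (rule coordinate_bounded_functional, simp)
  then have "openin ball_topology S"
    unfolding openin_subtopology S_def by blast
  ultimately show ?thesis by blast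
qed

end

section \<open>The equivalence\<close>

theorem theorem3p4:
  fixes w :: "nat \<Rightarrow> real" and \<phi> :: "real \<Rightarrow> real"
  assumes "weight_sequence w"
    and "(\<Sum>k. ennreal (w k)) = \<infinity>"
    and "orlicz_N_function \<phi>"
  shows "(\<forall>S. S \<noteq> {} \<and>
             openin (subtopology (weak_topology_on (ol_space \<phi> w) (luxemburg_norm \<phi> w))
                       (ol_unit_ball \<phi> w)) S
           \<longrightarrow> norm_diameter (luxemburg_norm \<phi> w) S = 2)
         \<longleftrightarrow> \<not> delta2_zero \<phi>"
proof -
  interpret orlicz_lorentz \<phi> w
    using assms by unfold_locales (auto simp: orlicz_N_function_def)
  have "\<not> summable w"
    using suminf_ennreal2[of w] assms(2) w_pos by (auto simp: less_imp_le)
  then show ?thesis using norm_diameter_weakly_open ex_small_slice by meson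
qed

end
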